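(* For $U=B(0,1)\subset\mathbb{R}^3$ and $x\in\mathbb{R}^3$, \[ M_c(\chi_U)(x)= \begin{cases} 1,&\|x\|<1,\\[2pt] \displaystyle\frac12,&\|x\|=1,\\[6pt] \displaystyle\frac12-\frac12\sqrt{\frac{\|x\|-1}{\|x\|+3}}\left(1+\frac{2}{\|x\|}\right),&\|x\|>1. \end{cases} \] For $\|x\|>1$ the unique maximizing radius, i.e. the unique $r>0$ at which $r\mapsto |U\cap B(x,r)|/|B(x,r)|$ attains its supremum over $r>0$, is \[ r_x=\sqrt{(\|x\|-1)(\|x\|+3)}. \]
   Context: $B(x,r)=\{y\in\mathbb{R}^3:\|x-y\|<r\}$ is the open Euclidean ball and $|E|$ is Lebesgue measure. For $f\in L^1_{\mathrm{loc}}(\mathbb{R}^3)$, the central Hardy--Littlewood maximal function is $M_cf(x)=\sup_{r>0}\frac{1}{|B(x,r)|}\int_{B(x,r)}|f(t)|\,dt$. $\chi_A$ denotes the characteristic function of $A$. *)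

theory Defs
  imports "HOL-Analysis.Analysis"
begin

text \<open>
  The supremum is taken in the extended reals, because the maximal function of a locally
  integrable function may be infinite. The Bochner integral of a function that is not
  integrable on the ball is \<open>0\<close>, so the definition is meaningful for locally integrable
  \<open>f\<close> only.
\<close>

definition central_maximal :: "(real^3 \<Rightarrow> real) \<Rightarrow> real^3 \<Rightarrow> ereal" where
  "central_maximal f x =
     (SUP r\<in>{0<..}. ereal (1 / measure lebesgue (ball x r) *
                            (LINT t:ball x r|lebesgue. \<bar>f t\<bar>)))"

end

theory Submission
  imports Defs
begin

text \<open>
  The maximal function of an indicator is the supremum over \<open>r\<close> of the density
  \<open>Q r = \<bar>U \<inter> B(x,r)\<bar> / \<bar>B(x,r)\<bar>\<close>, so everything rests on the volume of a lens, the intersection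
  of two balls. It is computed by rotating the centres onto the first axis and slicing: every
  slice is a disk, and the integral of its area splits at the plane through the circle in which
  the two spheres meet (\<open>measure_lens\<close>).

  Write \<open>d = \<parallel>x\<parallel>\<close>. For \<open>d < 1\<close> small balls lie inside \<open>U\<close>, so the density reaches its upper bound
  \<open>1\<close>. For \<open>d = 1\<close> the lens formula gives \<open>Q r = 1/2 - 3r/16\<close> for \<open>r \<le> 2\<close>, and the supremum
  \<open>1/2\<close> is the limit at \<open>0\<close>.

  For \<open>d > 1\<close> the density is \<open>0\<close> up to \<open>r = d - 1\<close> and \<open>1/r\<^sup>3\<close> from \<open>r = d + 1\<close> on, so a maximum
  over \<open>(d - 1, d + 1]\<close> is a global one. On that interval \<open>16 d r\<^sup>3 Q r\<close> is a quartic in \<open>r\<close>.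
  If \<open>c\<close> is the claimed value and \<open>\<rho>\<close> the claimed radius, the
  quartic \<open>16 d r\<^sup>3 (c - Q r)\<close> has the double root \<open>\<rho>\<close>, and the remaining quadratic factor is
  positive for \<open>r > d - 1\<close> (\<open>ball_density_unit_ball_lens_deficit\<close>). This gives the maximum and
  its uniqueness together.
\<close>

section \<open>Slicing three-dimensional volume into planar areas\<close>

lemma Basis_real3: "(Basis :: (real^3) set) = {axis 1 1, axis 2 1, axis 3 1}"
  by (auto simp: Basis_vec_def UNIV_3)

lemma continuous_on_vector3:
  "continuous_on UNIV (\<lambda>(a :: real, b :: real, c :: real). vector [a, b, c] :: real^3)"
proof -
  have "(\<lambda>(a :: real, b :: real, c :: real). vector [a, b, c] :: real^3) =
      (\<lambda>p. \<chi> i. if i = 1 then fst p else if i = 2 then fst (snd p) else snd (snd p))"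
    by (auto simp: vec_eq_iff forall_3)
  moreover have "continuous_on UNIV
      (\<lambda>p :: real \<times> real \<times> real. if i = 1 then fst p else if i = 2 then fst (snd p) else snd (snd p))" for i :: 3
    by (cases "i = 1"; cases "i = 2") (auto intro!: continuous_intros)
  ultimately show ?thesis
    by (simp only: continuous_on_vec_lambda)
qed

lemma emeasure_lborel_Times:
  fixes A :: "'a::euclidean_space set" and B :: "'b::euclidean_space set"
  assumes "A \<in> sets borel" "B \<in> sets borel"
  shows "emeasure lborel (A \<times> B) = emeasure lborel A * emeasure lborel B"
  unfolding lborel_prod[symmetric] using assms
  by (simp add: lborel.emeasure_pair_measure_Times)

text \<open>
  The coordinate isomorphism with the iterated product transfers volume in \<open>real^3\<close> to a product
  measure, to which Fubini's theorem applies. The two measures agree because they agree on boxes.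
\<close>

lemma lborel_real3_eq_distr:
  "(lborel :: (real^3) measure) =
     distr lborel borel (\<lambda>(a :: real, b :: real, c :: real). vector [a, b, c])"
proof (rule lborel_eqI)
  let ?h = "\<lambda>(a :: real, b :: real, c :: real). (vector [a, b, c] :: real^3)"
  have meas [measurable]: "?h \<in> borel_measurable borel"
    using continuous_on_vector3 by (rule borel_measurable_continuous_onI)
  fix l u :: "real^3"
  assume le: "\<And>b. b \<in> Basis \<Longrightarrow> l \<bullet> b \<le> u \<bullet> b"
  have le': "l $ 1 \<le> u $ 1" "l $ 2 \<le> u $ 2" "l $ 3 \<le> u $ 3"
    using le[of "axis 1 1"] le[of "axis 2 1"] le[of "axis 3 1"]
    by (auto simp: Basis_real3 inner_axis)
  have "?h -` box l u = box (l $ 1, l $ 2, l $ 3) (u $ 1, u $ 2, u $ 3)"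
    by (auto simp: mem_box Basis_real3 inner_axis Basis_prod_def)
  then have "emeasure (distr lborel borel ?h) (box l u) =
      emeasure lborel (box (l $ 1, l $ 2, l $ 3) (u $ 1, u $ 2, u $ 3))"
    by (subst emeasure_distr) auto
  also have "box (l $ 1, l $ 2, l $ 3) (u $ 1, u $ 2, u $ 3) =
      box (l $ 1) (u $ 1) \<times> box (l $ 2) (u $ 2) \<times> box (l $ 3) (u $ 3)"
    by (auto simp: mem_box Basis_prod_def)
  also have "emeasure lborel \<dots> = ennreal ((u $ 1 - l $ 1) * ((u $ 2 - l $ 2) * (u $ 3 - l $ 3)))"
    using le' by (simp add: emeasure_lborel_Times borel_Times ennreal_mult)
  also have "(u $ 1 - l $ 1) * ((u $ 2 - l $ 2) * (u $ 3 - l $ 3)) = (\<Prod>b\<in>Basis. (u - l) \<bullet> b)"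
    by (simp add: Basis_real3 inner_axis axis_eq_axis)
  finally show "emeasure (distr lborel borel ?h) (box l u) = (\<Prod>b\<in>Basis. (u - l) \<bullet> b)" .
qed simp

lemma emeasure_lborel_real3_slices:
  fixes S :: "(real^3) set"
  assumes "open S"
  shows "emeasure lborel S =
    (\<integral>\<^sup>+a. emeasure lborel {(b :: real, c :: real). vector [a, b, c] \<in> S} \<partial>lborel)"
proof -
  let ?h = "\<lambda>(a :: real, b :: real, c :: real). (vector [a, b, c] :: real^3)"
  have meas: "?h \<in> borel_measurable borel"
    using continuous_on_vector3 by (rule borel_measurable_continuous_onI)
  have "open (?h -` S)"
    using assms continuous_on_vector3 by (rule open_vimage)
  then have X: "?h -` S \<in> sets (lborel \<Otimes>\<^sub>M lborel)"
    unfolding lborel_prod by simp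
  have "emeasure lborel S = emeasure lborel (?h -` S)"
    using meas assms by (subst lborel_real3_eq_distr, subst emeasure_distr) auto
  also have "\<dots> = (\<integral>\<^sup>+a. emeasure lborel (Pair a -` ?h -` S) \<partial>lborel)"
    using lborel.emeasure_pair_measure_alt[OF X] by (simp add: lborel_prod)
  also have "\<dots> = (\<integral>\<^sup>+a. emeasure lborel {(b :: real, c :: real). vector [a, b, c] \<in> S} \<partial>lborel)"
    by (intro nn_integral_cong arg_cong2[where f = emeasure]) auto
  finally show ?thesis .
qed

lemma emeasure_lborel_disk:
  "emeasure lborel {(b :: real, c :: real). b\<^sup>2 + c\<^sup>2 < s} = ennreal (pi * max 0 s)"
proof -
  have "{(b :: real, c :: real). b\<^sup>2 + c\<^sup>2 < s} = ball 0 (sqrt (max 0 s))"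
    by (auto simp: norm_Pair max_def dest: order_less_le_trans[OF _ zero_le_power2] intro: real_sqrt_less_mono)
       (smt (verit) zero_le_power2)+
  moreover have "(sqrt (max 0 s))\<^sup>2 = max 0 s"
    by simp
  ultimately show ?thesis
    by (simp add: emeasure_ball unit_ball_vol_2)
qed

section \<open>The volume of a lens\<close>

text \<open>
  The inequalities say that \<open>d\<close>, \<open>R\<close> and \<open>r\<close> are the sides of a possibly degenerate triangle, that
  is, that the two spheres meet. The radical plane \<open>a = m\<close> through their common circle cuts the
  lens into two spherical caps: left of it the slice is bounded by the sphere of radius \<open>r\<close>, right of
  it by the sphere around the origin.
\<close>

lemma emeasure_lens_on_axis:
  fixes d R r :: real
  assumes "d > 0" "0 \<le> R" "0 \<le> r" "d \<le> R + r" "R \<le> d + r" "r \<le> d + R"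
  shows "emeasure lborel (ball (0 :: real^3) R \<inter> ball (d *\<^sub>R axis 1 1) r) =
    ennreal (pi * (R + r - d)\<^sup>2 * (d\<^sup>2 + 2 * d * (R + r) - 3 * (R - r)\<^sup>2) / (12 * d))"
proof -
  define m where "m = (R\<^sup>2 - r\<^sup>2 + d\<^sup>2) / (2 * d)"
  let ?g = "\<lambda>a. pi * max 0 (min (R\<^sup>2 - a\<^sup>2) (r\<^sup>2 - (a - d)\<^sup>2))"
  have m: "2 * d * m = R\<^sup>2 - r\<^sup>2 + d\<^sup>2"
    using assms by (simp add: m_def)
  \<comment> \<open>The triangle inequalities place the radical plane within the extent of both balls.\<close>
  have "2 * d * (R - m) = (r - (R - d)) * (r + (R - d))"
    unfolding right_diff_distrib m by algebra
  moreover have "2 * d * (m - (d - r)) = (R - (d - r)) * (R + (d - r))"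
    unfolding right_diff_distrib m by algebra
  moreover have "2 * d * (m + R) = (d + R - r) * (d + R + r)"
    unfolding distrib_left m by algebra
  moreover have "2 * d * (d + r - m) = (d + r - R) * (d + r + R)"
    unfolding right_diff_distrib m by algebra
  ultimately have ord: "m \<le> R" "d - r \<le> m" "- R \<le> m" "m \<le> d + r"
    using assms by (smt (verit) mult_nonneg_nonneg mult_pos_neg)+
  have switch: "(r\<^sup>2 - (a - d)\<^sup>2) - (R\<^sup>2 - a\<^sup>2) = 2 * d * (a - m)" for a
    unfolding right_diff_distrib m by algebra
  have ballR: "R\<^sup>2 - a\<^sup>2 = (R - a) * (R + a)" and ballr: "r\<^sup>2 - (a - d)\<^sup>2 = (a - (d - r)) * (d + r - a)" for a
    by algebra+
  have left: "?g a = pi * (r\<^sup>2 - (a - d)\<^sup>2)" if "a \<in> {d - r..m}" for a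
  proof -
    have "0 \<le> r\<^sup>2 - (a - d)\<^sup>2"
      unfolding ballr using that ord by auto
    moreover have "2 * d * (a - m) \<le> 0"
      using that assms by (intro mult_nonneg_nonpos) auto
    ultimately show ?thesis
      using switch[of a] by simp
  qed
  have right: "?g a = pi * (R\<^sup>2 - a\<^sup>2)" if "a \<in> {m..R}" for a
  proof -
    have "0 \<le> R\<^sup>2 - a\<^sup>2"
      unfolding ballR using that ord by auto
    moreover have "2 * d * (a - m) \<ge> 0"
      using that assms by (intro mult_nonneg_nonneg) auto
    ultimately show ?thesis
      using switch[of a] by simp
  qed
  have outside: "?g a = 0" if "a \<notin> {d - r..R}" for a
  proof -
    have "r\<^sup>2 - (a - d)\<^sup>2 < 0 \<or> R\<^sup>2 - a\<^sup>2 < 0"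
      unfolding ballR ballr using that assms by (auto simp: mult_less_0_iff)
    then show ?thesis by auto
  qed
  have Il: "((\<lambda>a. pi * (r\<^sup>2 - (a - d)\<^sup>2)) has_integral
      pi * (r\<^sup>2 * m - (m - d)^3 / 3) - pi * (r\<^sup>2 * (d - r) - (d - r - d)^3 / 3)) {d - r..m}"
    using ord by (intro fundamental_theorem_of_calculus)
      (auto intro!: derivative_eq_intros simp: has_real_derivative_iff_has_vector_derivative[symmetric] power2_eq_square)
  have Ir: "((\<lambda>a. pi * (R\<^sup>2 - a\<^sup>2)) has_integral
      pi * (R\<^sup>2 * R - R^3 / 3) - pi * (R\<^sup>2 * m - m^3 / 3)) {m..R}"
    using ord by (intro fundamental_theorem_of_calculus)
      (auto intro!: derivative_eq_intros simp: has_real_derivative_iff_has_vector_derivative[symmetric] power2_eq_square)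
  have "(?g has_integral
      (pi * (r\<^sup>2 * m - (m - d)^3 / 3) - pi * (r\<^sup>2 * (d - r) - (d - r - d)^3 / 3)) +
      (pi * (R\<^sup>2 * R - R^3 / 3) - pi * (R\<^sup>2 * m - m^3 / 3))) {d - r..R}"
    using ord has_integral_cong[THEN iffD2, OF left Il] has_integral_cong[THEN iffD2, OF right Ir]
    by (intro has_integral_combine) auto
  also have "(pi * (r\<^sup>2 * m - (m - d)^3 / 3) - pi * (r\<^sup>2 * (d - r) - (d - r - d)^3 / 3)) +
      (pi * (R\<^sup>2 * R - R^3 / 3) - pi * (R\<^sup>2 * m - m^3 / 3)) =
      pi * (R + r - d)\<^sup>2 * (d\<^sup>2 + 2 * d * (R + r) - 3 * (R - r)\<^sup>2) / (12 * d)" (is "?I = ?V")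
  proof -
    let ?J = "d^3 / 3 - r\<^sup>2 * d + 2 * (r^3 + R^3) / 3"
    \<comment> \<open>The cubes of \<open>m\<close> cancel, and \<open>m\<close> enters the rest only through \<open>2 * d * m\<close>.\<close>
    have "?I = pi * (d * m\<^sup>2 - m * (R\<^sup>2 - r\<^sup>2 + d\<^sup>2) + ?J)"
      by (simp add: field_simps power2_eq_square power3_eq_cube)
    also have "\<dots> = pi * (?J - d * m\<^sup>2)"
      unfolding m[symmetric] by (simp add: algebra_simps power2_eq_square)
    finally have I: "?I = pi * (?J - d * m\<^sup>2)" .
    have "12 * d * ?I = pi * (12 * d * ?J - 3 * (2 * d * m)\<^sup>2)"
      unfolding I by (simp add: algebra_simps power2_eq_square)
    also have "\<dots> = pi * (R + r - d)\<^sup>2 * (d\<^sup>2 + 2 * d * (R + r) - 3 * (R - r)\<^sup>2)"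
      unfolding m by (simp add: field_simps power2_eq_square power3_eq_cube)
    finally have "12 * d * ?I = pi * (R + r - d)\<^sup>2 * (d\<^sup>2 + 2 * d * (R + r) - 3 * (R - r)\<^sup>2)" .
    moreover have "y = z / c" if "c * y = z" "c \<noteq> 0" for c y z :: real
      using that by (simp add: field_simps)
    ultimately show ?thesis using assms by (metis less_irrefl mult_pos_pos zero_less_numeral)
  qed
  finally have "(?g has_integral ?V) {d - r..R}" .
  then have int: "(?g has_integral ?V) UNIV"
    using outside by (rule has_integral_on_superset) auto
  have slice: "{(b :: real, c :: real). vector [a, b, c] \<in> ball (0 :: real^3) R \<inter> ball (d *\<^sub>R axis 1 1) r} =
      {(b, c). b\<^sup>2 + c\<^sup>2 < min (R\<^sup>2 - a\<^sup>2) (r\<^sup>2 - (a - d)\<^sup>2)}" for a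
  proof -
    have "sqrt t < s \<longleftrightarrow> t < s\<^sup>2" if "0 \<le> s" for s t :: real
      using that by (metis abs_of_nonneg real_sqrt_abs real_sqrt_less_iff)
    then show ?thesis
      using assms
      by (auto simp: mem_ball dist_norm norm_vec_def L2_set_def sum_3 axis_def power2_commute[of d])
  qed
  have "emeasure lborel (ball (0 :: real^3) R \<inter> ball (d *\<^sub>R axis 1 1) r) =
      (\<integral>\<^sup>+a. ennreal (?g a) \<partial>lborel)"
    by (simp only: emeasure_lborel_real3_slices open_Int open_ball slice emeasure_lborel_disk)
  also have "\<dots> = ennreal ?V"
    by (rule nn_integral_has_integral_lborel[OF _ _ int]) auto
  finally show ?thesis .
qed

lemma measure_lens:
  fixes x :: "real^3" and R r :: real
  assumes "x \<noteq> 0" "0 \<le> R" "0 \<le> r"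
    and "norm x \<le> R + r" "R \<le> norm x + r" "r \<le> norm x + R"
  shows "measure lebesgue (ball 0 R \<inter> ball x r) =
    pi * (R + r - norm x)\<^sup>2 * ((norm x)\<^sup>2 + 2 * norm x * (R + r) - 3 * (R - r)\<^sup>2) / (12 * norm x)"
    (is "_ = ?V")
proof -
  let ?p = "norm x *\<^sub>R axis 1 1 :: real^3"
  have "norm ?p = norm x" by simp
  then obtain f where f: "orthogonal_transformation f" "f ?p = x"
    by (rule orthogonal_transformation_exists)
  have "f ` (ball 0 R \<inter> ball ?p r) = ball 0 R \<inter> ball x r"
    using f image_Int[OF orthogonal_transformation_inj[OF f(1)]]
    by (simp add: image_orthogonal_transformation_ball orthogonal_transformation_linear linear_0)
  then have "measure lebesgue (ball 0 R \<inter> ball x r) = measure lebesgue (ball 0 R \<inter> ball ?p r)"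
    using measure_orthogonal_image[OF f(1), of "ball 0 R \<inter> ball ?p r"]
    by (metis fmeasurable_Int_fmeasurable fmeasurableD lmeasurable_ball)
  also have "\<dots> = measure lborel (ball 0 R \<inter> ball ?p r)"
    by (simp add: measure_completion)
  also have "\<dots> = ?V"
  proof -
    \<comment> \<open>\<open>ennreal\<close> truncates negative numbers, so the volume formula has to be known nonnegative.\<close>
    have "3 * (R - r)\<^sup>2 = 3 * \<bar>R - r\<bar> * \<bar>R - r\<bar>"
      by (simp add: power2_eq_square)
    also have "\<dots> \<le> norm x * norm x + 2 * norm x * (R + r)"
    proof -
      have "\<bar>R - r\<bar> \<le> norm x" "\<bar>R - r\<bar> \<le> R + r" using assms by auto
      then have "\<bar>R - r\<bar> * \<bar>R - r\<bar> \<le> norm x * norm x" "\<bar>R - r\<bar> * \<bar>R - r\<bar> \<le> norm x * (R + r)"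
        by (intro mult_mono; simp)+
      then show ?thesis by linarith
    qed
    finally have "0 \<le> ?V"
      by (intro divide_nonneg_nonneg mult_nonneg_nonneg) (auto simp: power2_eq_square)
    then show ?thesis
      using assms emeasure_lens_on_axis[of "norm x" R r] by (simp add: measure_def)
  qed
  finally show ?thesis .
qed


section \<open>The density of a set in a ball\<close>

definition ball_density :: "(real^3) set \<Rightarrow> real^3 \<Rightarrow> real \<Rightarrow> real" where
  "ball_density U x r = measure lebesgue (U \<inter> ball x r) / measure lebesgue (ball x r)"

lemma central_maximal_indicator:
  "central_maximal (indicator U) x = (SUP r\<in>{0<..}. ereal (ball_density U x r))"
proof -
  have "(LINT t:ball x r|lebesgue. \<bar>indicator U t\<bar>) = measure lebesgue (U \<inter> ball x r)" for r
  proof -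
    have "(\<lambda>t. indicator (ball x r) t *\<^sub>R \<bar>indicator U t :: real\<bar>) = indicator (U \<inter> ball x r)"
      by (auto simp: fun_eq_iff split: split_indicator)
    then show ?thesis
      by (simp add: set_lebesgue_integral_def)
  qed
  then show ?thesis
    by (simp add: central_maximal_def ball_density_def)
qed

lemma ball_density_le_1:
  assumes "U \<in> sets lebesgue" "0 < r"
  shows "ball_density U x r \<le> 1"
proof -
  have "measure lebesgue (U \<inter> ball x r) \<le> measure lebesgue (ball x r)"
    using assms by (intro measure_mono_fmeasurable) auto
  then show ?thesis
    using assms by (simp add: ball_density_def sphere_volume)
qed

lemma ball_density_eq_1:
  assumes "0 < r" "ball x r \<subseteq> U"
  shows "ball_density U x r = 1"
  using assms by (simp add: ball_density_def sphere_volume Int_absorb1)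

section \<open>The density of the unit ball\<close>

lemma ball_density_unit_ball_disjoint:
  assumes "1 + r \<le> norm x"
  shows "ball_density (ball 0 1) x r = 0"
proof -
  have "ball 0 1 \<inter> ball x r = {}"
    using assms by (intro disjoint_ballI) simp
  then show ?thesis by (simp add: ball_density_def)
qed

lemma ball_density_unit_ball_contained:
  assumes "norm x + 1 \<le> r"
  shows "ball_density (ball 0 1) x r = 1 / r ^ 3"
proof -
  have "ball 0 1 \<subseteq> ball x r"
    using assms by (simp add: ball_subset_ball_iff)
  moreover have "0 < r" using assms by (smt (verit) norm_ge_zero)
  ultimately show ?thesis
    by (simp add: ball_density_def sphere_volume Int_absorb2)
qed

lemma ball_density_unit_ball_lens:
  assumes "x \<noteq> 0" "0 < r" "\<bar>1 - r\<bar> \<le> norm x" "norm x \<le> 1 + r"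
  shows "ball_density (ball 0 1) x r =
    (1 + r - norm x)\<^sup>2 * ((norm x)\<^sup>2 + 2 * norm x * (1 + r) - 3 * (1 - r)\<^sup>2) / (16 * norm x * r ^ 3)"
  using assms measure_lens[of x 1 r]
  by (simp add: ball_density_def sphere_volume)

text \<open>
  Here \<open>t\<close> and \<open>\<rho>\<close> stand for \<open>sqrt ((d - 1) / (d + 3))\<close> and \<open>sqrt ((d - 1) * (d + 3))\<close>; the two
  hypotheses are all that is used of the square roots, which makes the identity polynomial. The
  quartic subtracted on the left is the numerator of the density, and \<open>8 * (d - t * (d + 2))\<close> is
  \<open>16 * d\<close> times the claimed maximum. The numerator has no linear term in \<open>r\<close>, which determines
  the middle coefficient of the quadratic factor.
\<close>

lemma lens_polynomial_double_root:
  fixes d r \<rho> t :: real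
  assumes "t * \<rho> = d - 1" "t * (d + 3) = \<rho>"
  shows "8 * (d - t * (d + 2)) * r ^ 3 - (1 + r - d)\<^sup>2 * (d\<^sup>2 + 2 * d * (1 + r) - 3 * (1 - r)\<^sup>2) =
    (r - \<rho>)\<^sup>2 * (3 * r\<^sup>2 - 2 * (d - 1) * t * r - (d - 1)\<^sup>2)"
proof -
  have "(1 + r - d)\<^sup>2 * (d\<^sup>2 + 2 * d * (1 + r) - 3 * (1 - r)\<^sup>2) =
    - 3 * r ^ 4 + 8 * d * r ^ 3 - 6 * (d - 1) * (d + 1) * r\<^sup>2 + (d - 1) ^ 3 * (d + 3)"
    by algebra
  moreover have "(r - \<rho>)\<^sup>2 * (3 * r\<^sup>2 - 2 * (d - 1) * t * r - (d - 1)\<^sup>2) =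
    3 * r ^ 4 - 8 * (t * (d + 2)) * r ^ 3 + 6 * (d - 1) * (d + 1) * r\<^sup>2 - (d - 1) ^ 3 * (d + 3)"
    using assms by algebra
  ultimately show ?thesis
    by (simp add: algebra_simps)
qed

text \<open>
  The quadratic factor is positive because \<open>t \<le> 1\<close> bounds it below by
  \<open>(3 * r + (d - 1)) * (r - (d - 1))\<close>.
\<close>

lemma ball_density_unit_ball_lens_deficit:
  fixes x :: "real^3"
  defines "d \<equiv> norm x"
  defines "\<rho> \<equiv> sqrt ((d - 1) * (d + 3))" and "t \<equiv> sqrt ((d - 1) / (d + 3))"
  assumes "1 < d" "d - 1 < r" "r \<le> d + 1"
  shows "1 / 2 - 1 / 2 * t * (1 + 2 / d) - ball_density (ball 0 1) x r =
      (r - \<rho>)\<^sup>2 * (3 * r\<^sup>2 - 2 * (d - 1) * t * r - (d - 1)\<^sup>2) / (16 * d * r ^ 3)" (is ?eq)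
    and "0 < 3 * r\<^sup>2 - 2 * (d - 1) * t * r - (d - 1)\<^sup>2" (is ?pos)
proof -
  have "t * \<rho> = sqrt ((d - 1)\<^sup>2)"
    using assms(4) by (simp add: \<rho>_def t_def power2_eq_square flip: real_sqrt_mult)
  then have t\<rho>: "t * \<rho> = d - 1"
    using assms(4) by simp
  have "t * (d + 3) = t * sqrt ((d + 3)\<^sup>2)"
    using assms(4) by simp
  also have "\<dots> = sqrt ((d - 1) / (d + 3) * (d + 3)\<^sup>2)"
    unfolding t_def by (rule real_sqrt_mult[symmetric])
  also have "\<dots> = \<rho>"
    using assms(4) by (simp add: \<rho>_def power2_eq_square)
  finally have t3: "t * (d + 3) = \<rho>" .
  have "x \<noteq> 0" using assms by auto
  then have dens: "ball_density (ball 0 1) x r =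
      (1 + r - d)\<^sup>2 * (d\<^sup>2 + 2 * d * (1 + r) - 3 * (1 - r)\<^sup>2) / (16 * d * r ^ 3)"
    using assms(4-6) unfolding d_def by (intro ball_density_unit_ball_lens) auto
  have "1 / 2 - 1 / 2 * t * (1 + 2 / d) = 8 * (d - t * (d + 2)) * r ^ 3 / (16 * d * r ^ 3)"
    using assms(4-6) by (simp add: divide_simps)
  then show ?eq
    unfolding dens lens_polynomial_double_root[OF t\<rho> t3, symmetric] by (simp add: diff_divide_distrib)
  have "t \<le> 1"
    using assms(4) by (simp add: t_def)
  then have "2 * (d - 1) * r * t \<le> 2 * (d - 1) * r"
    using assms(4-6) by (intro mult_left_le) auto
  moreover have "0 < (3 * r + (d - 1)) * (r - (d - 1))"
  proof (rule mult_pos_pos)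
    show "0 < 3 * r + (d - 1)"
      using assms(4) less_trans[OF _ assms(5), of 0] by (intro add_pos_pos) auto
    show "0 < r - (d - 1)"
      using assms(5) by simp
  qed
  ultimately show ?pos
    by (simp add: algebra_simps power2_eq_square)
qed

text \<open>
  Since \<open>d - 1 < \<rho> < d + 1\<close>, the endpoint \<open>d + 1\<close> is covered by the strict inequality on the lens
  interval. It is the comparison point for all radii outside that interval: the density vanishes
  for \<open>r \<le> d - 1\<close>, and it decreases once the ball contains the unit ball.
\<close>

lemma ball_density_unit_ball_strict_max:
  fixes x :: "real^3"
  defines "d \<equiv> norm x"
  defines "\<rho> \<equiv> sqrt ((d - 1) * (d + 3))"
    and "c \<equiv> 1 / 2 - 1 / 2 * sqrt ((d - 1) / (d + 3)) * (1 + 2 / d)"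
  assumes d: "1 < d"
  shows "0 < \<rho>" and "ball_density (ball 0 1) x \<rho> = c"
    and "0 < r \<Longrightarrow> r \<noteq> \<rho> \<Longrightarrow> ball_density (ball 0 1) x r < c"
proof -
  note deficit = ball_density_unit_ball_lens_deficit[of x, folded d_def, folded \<rho>_def c_def]
  have "(d - 1)\<^sup>2 < (d - 1) * (d + 3)" "(d - 1) * (d + 3) < (d + 1)\<^sup>2"
    using d by (auto simp: power2_eq_square algebra_simps)
  then have \<rho>: "d - 1 < \<rho>" "\<rho> < d + 1"
    using d by (auto simp: \<rho>_def intro: real_less_rsqrt real_less_lsqrt)
  then show "0 < \<rho>"
    using d by simp
  show eq: "ball_density (ball 0 1) x \<rho> = c"
    using deficit(1)[OF d, of \<rho>] \<rho> by simp
  have lens: "ball_density (ball 0 1) x r < c" if r: "d - 1 < r" "r \<le> d + 1" "r \<noteq> \<rho>" for r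
  proof -
    have "0 < c - ball_density (ball 0 1) x r"
      unfolding deficit(1)[OF d r(1,2)] using r d deficit(2)[OF d r(1,2)]
      by (intro divide_pos_pos mult_pos_pos) auto
    then show ?thesis by simp
  qed
  have far: "ball_density (ball 0 1) x (d + 1) < c"
    using \<rho> by (intro lens) auto
  show "ball_density (ball 0 1) x r < c" if r: "0 < r" "r \<noteq> \<rho>"
  proof -
    consider "r \<le> d - 1" | "d - 1 < r" "r \<le> d + 1" | "d + 1 < r"
      by linarith
    then show ?thesis
    proof cases
      case 1
      then have "ball_density (ball 0 1) x r = 0"
        unfolding d_def by (intro ball_density_unit_ball_disjoint) auto
      moreover have "0 \<le> ball_density (ball 0 1) x (d + 1)"
        by (simp add: ball_density_def)
      ultimately show ?thesis using far by simp
    next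
      case 2
      then show ?thesis using lens r by blast
    next
      case 3
      then have "ball_density (ball 0 1) x r = 1 / r ^ 3"
          "ball_density (ball 0 1) x (d + 1) = 1 / (d + 1) ^ 3"
        unfolding d_def by (intro ball_density_unit_ball_contained; simp)+
      moreover have "1 / r ^ 3 \<le> 1 / (d + 1) ^ 3"
        using 3 d by (intro divide_left_mono power_mono mult_pos_pos zero_less_power) auto
      ultimately show ?thesis using far by simp
    qed
  qed
qed

text \<open>
  For a centre on the unit sphere the two spheres meet exactly for radii up to the diameter \<open>2\<close>;
  on that range the lens formula becomes affine in the radius.
\<close>

lemma ball_density_unit_ball_sphere:
  assumes "norm x = 1" "0 < r"
  shows "ball_density (ball 0 1) x r = (if r \<le> 2 then 1 / 2 - 3 / 16 * r else 1 / r ^ 3)"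
proof (cases "r \<le> 2")
  case True
  have "x \<noteq> 0" using assms by auto
  then have "ball_density (ball 0 1) x r = r\<^sup>2 * (1 + 2 * (1 + r) - 3 * (1 - r)\<^sup>2) / (16 * r ^ 3)"
    using ball_density_unit_ball_lens[of x r] assms True by auto
  also have "\<dots> = 1 / 2 - 3 / 16 * r"
    using assms by (simp add: field_simps power2_eq_square power3_eq_cube)
  finally show ?thesis using True by simp
next
  case False
  then show ?thesis
    using ball_density_unit_ball_contained[of x r] assms by simp
qed

section \<open>The maximal function of the unit ball\<close>

theorem corollary3:
  fixes x :: "real^3" and U :: "(real^3) set"
  defines "U \<equiv> ball 0 1"
  shows
    "(norm x < 1 \<longrightarrow> central_maximal (indicator U) x = ereal 1) \<and>
     (norm x = 1 \<longrightarrow> central_maximal (indicator U) x = ereal (1 / 2)) \<and>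
     (norm x > 1 \<longrightarrow>
        central_maximal (indicator U) x =
          ereal (1 / 2 - 1 / 2 * sqrt ((norm x - 1) / (norm x + 3)) * (1 + 2 / norm x)) \<and>
        {r. r > 0 \<and>
            measure lebesgue (U \<inter> ball x r) / measure lebesgue (ball x r) =
              (SUP s\<in>{0<..}. measure lebesgue (U \<inter> ball x s) / measure lebesgue (ball x s))} =
          {sqrt ((norm x - 1) * (norm x + 3))})"
proof (intro conjI impI)
  assume inside: "norm x < 1"
  show "central_maximal (indicator U) x = ereal 1"
    unfolding central_maximal_indicator
  proof (rule antisym)
    show "(SUP r\<in>{0<..}. ereal (ball_density U x r)) \<le> ereal 1"
      by (intro SUP_least) (auto simp: U_def ball_density_le_1)
    have "ball x (1 - norm x) \<subseteq> U"
      by (simp add: U_def ball_subset_ball_iff)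
    then have "ball_density U x (1 - norm x) = 1"
      using inside by (intro ball_density_eq_1) auto
    then show "ereal 1 \<le> (SUP r\<in>{0<..}. ereal (ball_density U x r))"
      using inside by (intro SUP_upper2[of "1 - norm x"]) auto
  qed
next
  assume sphere: "norm x = 1"
  show "central_maximal (indicator U) x = ereal (1 / 2)"
    unfolding central_maximal_indicator
  proof (rule antisym)
    have "ball_density U x r \<le> 1 / 2" if "0 < r" for r
    proof (cases "r \<le> 2")
      case True
      then show ?thesis
        using that sphere by (simp add: U_def ball_density_unit_ball_sphere)
    next
      case False
      then have "2 ^ 3 \<le> r ^ 3"
        by (intro power_mono) auto
      then have "1 / r ^ 3 \<le> 1 / 2"
        using that by (simp add: field_simps)
      then show ?thesis
        using False that sphere by (simp add: U_def ball_density_unit_ball_sphere)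
    qed
    then show "(SUP r\<in>{0<..}. ereal (ball_density U x r)) \<le> ereal (1 / 2)"
      by (intro SUP_least) auto
    \<comment> \<open>The supremum is not attained: it is approached as the radius tends to \<open>0\<close>.\<close>
    have "((\<lambda>r. ereal (1 / 2 - 3 / 16 * r)) \<longlongrightarrow> ereal (1 / 2 - 3 / 16 * 0)) (at_right 0)"
      by (intro tendsto_intros)
    then have "((\<lambda>r. ereal (1 / 2 - 3 / 16 * r)) \<longlongrightarrow> ereal (1 / 2)) (at_right 0)"
      by simp
    then show "ereal (1 / 2) \<le> (SUP r\<in>{0<..}. ereal (ball_density U x r))"
    proof (rule tendsto_upperbound)
      have "ereal (1 / 2 - 3 / 16 * r) \<le> (SUP r\<in>{0<..}. ereal (ball_density U x r))"
        if "r \<in> {0<..<2}" for r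
        using that sphere
        by (intro SUP_upper2[of r]) (auto simp: U_def ball_density_unit_ball_sphere)
      then show "\<forall>\<^sub>F r in at_right 0.
          ereal (1 / 2 - 3 / 16 * r) \<le> (SUP r\<in>{0<..}. ereal (ball_density U x r))"
        by (auto intro!: eventually_at_rightI[of 0 2])
    qed simp
  qed
next
  assume outside: "norm x > 1"
  let ?\<rho> = "sqrt ((norm x - 1) * (norm x + 3))"
  let ?c = "1 / 2 - 1 / 2 * sqrt ((norm x - 1) / (norm x + 3)) * (1 + 2 / norm x)"
  note max = ball_density_unit_ball_strict_max[OF outside, folded U_def]
  have le: "ball_density U x r \<le> ?c" if "0 < r" for r
    using max(2) max(3)[OF that] by (cases "r = ?\<rho>") auto
  show "central_maximal (indicator U) x = ereal ?c"
    unfolding central_maximal_indicator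
  proof (rule antisym)
    show "(SUP r\<in>{0<..}. ereal (ball_density U x r)) \<le> ereal ?c"
      using le by (intro SUP_least) auto
    show "ereal ?c \<le> (SUP r\<in>{0<..}. ereal (ball_density U x r))"
      using max(1,2) by (intro SUP_upper2[of ?\<rho>]) auto
  qed
  have "(SUP s\<in>{0<..}. ball_density U x s) = ?c"
    using le max(1,2) by (intro cSup_eq_maximum) (auto simp: image_iff intro!: bexI[of _ ?\<rho>])
  then show "{r. r > 0 \<and>
      measure lebesgue (U \<inter> ball x r) / measure lebesgue (ball x r) =
        (SUP s\<in>{0<..}. measure lebesgue (U \<inter> ball x s) / measure lebesgue (ball x s))} = {?\<rho>}"
    using max unfolding ball_density_def[symmetric] by (auto, fastforce)
qed

end
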